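(* $I(2,1)=4$. That is, $4$ is the smallest number $m$ such that, for any normal topological space $T$ of covering dimension $1$, every null-homotopic matrix in $SL_2(\mathcal{C}(T))$ is a product of $m$ continuous involutions.
   Context: For a topological space $T$, $\mathcal{C}(T)$ is the ring of continuous complex-valued functions on $T$, and elements of $SL_n(\mathcal{C}(T))$ are identified with continuous maps $T\to SL_n(\mathbb{C})$; such an element is null-homotopic if this map is homotopic to a constant map through continuous maps $T\to SL_n(\mathbb{C})$. A continuous involution is a matrix $B\in GL_n(\mathcal{C}(T))$ with $B^2=I$. $I(n,d)$ denotes the smallest number such that, for any normal topological space $T$ of finite covering dimension $d$, every null-homotopic matrix in $SL_n(\mathcal{C}(T))$ is a product of $I(n,d)$ continuous involutions. *)

theory Defs
  imports "HOL-Analysis.Analysis"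
begin

(* Lebesgue (Cech) covering dimension at most d, in the form with finite open covers that is
   customary for normal spaces: order at most d means that no point lies in more than d + 1
   members of the refinement.  It is unrelated to the library's dim_le, which is the
   inductive dimension. *)
definition covering_dim_le :: "'a topology \<Rightarrow> nat \<Rightarrow> bool" where
  "covering_dim_le T d \<longleftrightarrow>
     (\<forall>\<U>. finite \<U> \<and> (\<forall>U\<in>\<U>. openin T U) \<and> \<Union>\<U> = topspace T \<longrightarrow>
        (\<exists>\<V>. finite \<V> \<and> (\<forall>V\<in>\<V>. openin T V) \<and> \<Union>\<V> = topspace T
             \<and> (\<forall>V\<in>\<V>. \<exists>U\<in>\<U>. V \<subseteq> U)
             \<and> (\<forall>x\<in>topspace T. card {V\<in>\<V>. x \<in> V} \<le> d + 1)))"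

(* The empty space has dimension -1, hence no dimension d :: nat. *)
definition has_covering_dim :: "'a topology \<Rightarrow> nat \<Rightarrow> bool" where
  "has_covering_dim T d \<longleftrightarrow>
     topspace T \<noteq> {} \<and> covering_dim_le T d \<and> (\<forall>k<d. \<not> covering_dim_le T k)"

definition SL_set :: "(complex^'n^'n) set" where
  "SL_set = {M. det M = 1}"

definition GL_set :: "(complex^'n^'n) set" where
  "GL_set = {M. invertible M}"

(* A matrix over the ring of continuous complex-valued functions on T is represented by the
   corresponding matrix-valued map; its values outside topspace T are irrelevant. *)
definition SL_cont :: "'a topology \<Rightarrow> ('a \<Rightarrow> complex^'n^'n) \<Rightarrow> bool" where
  "SL_cont T A \<longleftrightarrow> continuous_map T (top_of_set SL_set) A"

definition null_homotopic_SL :: "'a topology \<Rightarrow> ('a \<Rightarrow> complex^'n^'n) \<Rightarrow> bool" where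
  "null_homotopic_SL T A \<longleftrightarrow>
     (\<exists>C\<in>SL_set. homotopic_with (\<lambda>_. True) T (top_of_set SL_set) A (\<lambda>_. C))"

definition continuous_involution :: "'a topology \<Rightarrow> ('a \<Rightarrow> complex^'n^'n) \<Rightarrow> bool" where
  "continuous_involution T B \<longleftrightarrow>
     continuous_map T (top_of_set GL_set) B \<and> (\<forall>x\<in>topspace T. B x ** B x = mat 1)"

definition product_of_involutions :: "'a topology \<Rightarrow> nat \<Rightarrow> ('a \<Rightarrow> complex^'n^'n) \<Rightarrow> bool" where
  "product_of_involutions T m A \<longleftrightarrow>
     (\<exists>Bs. length Bs = m \<and> (\<forall>B\<in>set Bs. continuous_involution T B)
         \<and> (\<forall>x\<in>topspace T. A x = foldr (\<lambda>B M. B x ** M) Bs (mat 1)))"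

(* The property of m whose least solution is I(CARD('n), d), for spaces T whose points have
   type 'a.  HOL cannot quantify over types inside a formula, so the type of points is a
   parameter: m suffices for all spaces iff it does at every type, and a lower bound obtained at
   one type is a lower bound for I(CARD('n), d). *)
definition involutions_suffice :: "'a itself \<Rightarrow> 'n::finite itself \<Rightarrow> nat \<Rightarrow> nat \<Rightarrow> bool" where
  "involutions_suffice _ _ d m \<longleftrightarrow>
     (\<forall>(T :: 'a topology) (A :: 'a \<Rightarrow> complex^'n^'n).
        normal_space T \<and> has_covering_dim T d \<and> SL_cont T A \<and> null_homotopic_SL T A
        \<longrightarrow> product_of_involutions T m A)"

end

theory Submission
  imports Defs
begin

text \<open>In covering dimension at most 1 the ring of continuous functions has stable rank 1: if \<open>a\<close>
  and \<open>b\<close> have no common zero, then \<open>a + t * b\<close> vanishes nowhere for some continuous \<open>t\<close>. For this,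
  \<open>a\<close> is deformed, where it is small compared with \<open>b\<close>, to a map whose values are positive multiples
  of boundary points of a triangle around \<open>0\<close>, given by a cover by three open sets without a common
  point. So a matrix \<open>A\<close> of
  determinant 1 is conjugate to \<open>L ** D ** U\<close> with \<open>D = diag(u, 1/u)\<close> and \<open>L\<close>, \<open>U\<close> lower and upper
  unitriangular. With \<open>\<sigma> = diag(1, -1)\<close>, the matrices \<open>L ** \<sigma>\<close> and \<open>\<sigma> ** U\<close> are involutions,
  \<open>D = \<sigma> ** D ** \<sigma>\<close>, and \<open>D\<close> is a product of two involutions, which makes four.

  If \<open>A\<close> is a product of three involutions over a connected space and is not scalar, then \<open>A\<close> is
  up to sign a product of two involutions of trace 0, so there is an involution \<open>B\<close> with
  \<open>trace B = trace (B ** A) = 0\<close>. On \<open>[-1, 1]\<close> this fails for a path that leaves the identity in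
  unipotent direction on one side of \<open>0\<close> and in diagonal direction on the other.\<close>

section \<open>Indexed refinements and subordinate functions\<close>

text \<open>Assign to each member of a refinement the index of some \<open>W i\<close> containing
  it, and let \<open>V i\<close> be the union of the members with index \<open>i\<close>. A point in
  all \<open>d + 2\<close> unions would lie in \<open>d + 2\<close> distinct members, against the
  order of the refinement.\<close>

lemma covering_dim_le_shrink_indexed:
  assumes dim: "covering_dim_le T d"
    and op: "\<And>i. i \<le> Suc d \<Longrightarrow> openin T (W i)"
    and cover: "(\<Union>i\<le>Suc d. W i) = topspace T"
  obtains V where "\<And>i. i \<le> Suc d \<Longrightarrow> openin T (V i)" "\<And>i. i \<le> Suc d \<Longrightarrow> V i \<subseteq> W i"
    "(\<Union>i\<le>Suc d. V i) = topspace T" "(\<Inter>i\<le>Suc d. V i) = {}"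
proof -
  have "finite (W ` {..Suc d}) \<and> (\<forall>U\<in>W ` {..Suc d}. openin T U) \<and> \<Union>(W ` {..Suc d}) = topspace T"
    using op cover by blast
  with dim obtain \<V> where fin: "finite \<V>" and opV: "\<And>V. V \<in> \<V> \<Longrightarrow> openin T V"
    and cov: "\<Union>\<V> = topspace T" and ref: "\<And>V. V \<in> \<V> \<Longrightarrow> \<exists>i\<le>Suc d. V \<subseteq> W i"
    and ord: "\<And>x. x \<in> topspace T \<Longrightarrow> card {V\<in>\<V>. x \<in> V} \<le> d + 1"
    unfolding covering_dim_le_def by (smt (verit, best) atMost_iff imageE)
  from ref obtain k where k: "\<And>V. V \<in> \<V> \<Longrightarrow> k V \<le> Suc d \<and> V \<subseteq> W (k V)"
    by metis
  define V where "V i = \<Union>{U\<in>\<V>. k U = i}" for i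
  have "(\<Inter>i\<le>Suc d. V i) = {}"
  proof (rule ccontr)
    assume "(\<Inter>i\<le>Suc d. V i) \<noteq> {}"
    then obtain x where x: "\<And>i. i \<le> Suc d \<Longrightarrow> x \<in> V i"
      by auto
    then have "{..Suc d} \<subseteq> k ` {U\<in>\<V>. x \<in> U}"
      unfolding V_def by (fastforce simp del: atMost_Suc)
    then have "card {..Suc d} \<le> card {U\<in>\<V>. x \<in> U}"
      using fin by (intro surj_card_le) auto
    moreover have "x \<in> topspace T"
      using x[of 0] opV openin_subset by (fastforce simp: V_def)
    ultimately show False
      using ord by fastforce
  qed
  moreover have "(\<Union>i\<le>Suc d. V i) = topspace T"
    unfolding V_def cov[symmetric] using k by (fastforce simp del: atMost_Suc)
  moreover have "openin T (V i)" for i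
    unfolding V_def using opV by blast
  moreover have "V i \<subseteq> W i" for i
    unfolding V_def using k by blast
  ultimately show ?thesis
    by (intro that)
qed

text \<open>Induction on \<open>I\<close>: Urysohn's lemma gives a function for \<open>V j\<close>
  that is positive on the part of \<open>C\<close> missed by the other sets. Its zero set in
  \<open>C\<close> is again closed and is covered by the remaining sets, which is why
  \<open>C\<close> has to be arbitrary.\<close>

lemma normal_space_subordinate_functions:
  assumes T: "normal_space T" and "finite I"
    and op: "\<And>i. i \<in> I \<Longrightarrow> openin T (V i)"
    and C: "closedin T C" "C \<subseteq> (\<Union>i\<in>I. V i)"
  shows "\<exists>f. (\<forall>i\<in>I. continuous_map T euclideanreal (f i)
              \<and> (\<forall>x\<in>topspace T. 0 \<le> f i x \<and> (x \<notin> V i \<longrightarrow> f i x = 0)))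
           \<and> (\<forall>x\<in>C. \<exists>i\<in>I. 0 < f i x)"
  using \<open>finite I\<close> op C
proof (induction I arbitrary: C rule: finite_induct)
  case empty
  then show ?case by auto
next
  case (insert j I)
  let ?U = "\<Union>i\<in>I. V i"
  have "openin T ?U"
    using insert by auto
  then have "closedin T (C - ?U)"
    using insert by (simp add: closedin_diff)
  moreover have "closedin T (topspace T - V j)"
    using insert by auto
  moreover have "disjnt (topspace T - V j) (C - ?U)"
    using insert by (auto simp: disjnt_iff)
  ultimately obtain g where g: "continuous_map T (top_of_set {0..1::real}) g"
    "g ` (topspace T - V j) \<subseteq> {0}" "g ` (C - ?U) \<subseteq> {1}"
    using Urysohn_lemma[OF T, of "topspace T - V j" "C - ?U" 0 1] by auto
  have gc: "continuous_map T euclideanreal g" and g0: "\<And>x. x \<in> topspace T \<Longrightarrow> 0 \<le> g x"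
    using g by (auto simp: continuous_map_in_subtopology)
  define D where "D = C \<inter> {x \<in> topspace T. g x \<in> {0}}"
  have "closedin T D"
    unfolding D_def using insert by (intro closedin_Int closedin_continuous_map_preimage[OF gc]) auto
  moreover have "D \<subseteq> ?U"
    using g by (auto simp: D_def)
  ultimately have "\<exists>f. (\<forall>i\<in>I. continuous_map T euclideanreal (f i)
              \<and> (\<forall>x\<in>topspace T. 0 \<le> f i x \<and> (x \<notin> V i \<longrightarrow> f i x = 0)))
           \<and> (\<forall>x\<in>D. \<exists>i\<in>I. 0 < f i x)"
    using insert.IH[of D] insert.prems(1) by blast
  then obtain f where f: "\<And>i. i \<in> I \<Longrightarrow> continuous_map T euclideanreal (f i)"
      "\<And>i x. i \<in> I \<Longrightarrow> x \<in> topspace T \<Longrightarrow> 0 \<le> f i x \<and> (x \<notin> V i \<longrightarrow> f i x = 0)"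
      "\<And>x. x \<in> D \<Longrightarrow> \<exists>i\<in>I. 0 < f i x"
    by blast
  have CT: "x \<in> topspace T" if "x \<in> C" for x
    using that insert.prems closedin_subset by blast
  have "\<exists>i\<in>insert j I. 0 < (f(j := g)) i x" if "x \<in> C" for x
  proof (cases "g x = 0")
    case True
    then show ?thesis
      using f(3)[of x] CT that insert.hyps unfolding D_def
      by (metis (mono_tags, lifting) IntI fun_upd_other insert_iff mem_Collect_eq)
  next
    case False
    then show ?thesis
      using g0[OF CT[OF that]] by auto
  qed
  then show ?case
    using f g gc g0 insert.hyps by (intro exI[of _ "f(j := g)"]) auto
qed

section \<open>Stable rank 1 in covering dimension at most 1\<close>

text \<open>The vertices of a triangle with \<open>0\<close> in its interior: the half-planes
  \<open>Re (z * cnj c\<^sub>k) > 0\<close> cover the punctured plane, while no side of the triangle meets \<open>0\<close>.\<close>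

definition triangle_vertex :: "nat \<Rightarrow> complex" where
  "triangle_vertex k = (if k = 0 then 1 else if k = 1 then Complex (-1) 1 else Complex (-1) (-1))"

lemma triangle_halfplanes_cover:
  assumes "z \<noteq> 0"
  shows "\<exists>k\<le>2. 0 < Re (z * cnj (triangle_vertex k))"
proof -
  \<comment> \<open>If all three failed, then \<open>\<bar>Im z\<bar> \<le> Re z \<le> 0\<close>, so
    \<open>z = 0\<close>.\<close>
  have "0 < Re z \<or> 0 < Im z - Re z \<or> 0 < - Im z - Re z"
    using assms by (auto simp: complex_eq_iff)
  moreover have "Re (z * cnj (triangle_vertex 0)) = Re z"
    "Re (z * cnj (triangle_vertex 1)) = Im z - Re z"
    "Re (z * cnj (triangle_vertex 2)) = - Im z - Re z"
    by (simp_all add: triangle_vertex_def)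
  ultimately show ?thesis
    by (metis le0 one_le_numeral order_refl)
qed

text \<open>Real coefficients with sum zero are proportional to 2, 1, 1; one zero coefficient then
  makes all of them zero, against the positive one.\<close>

lemma triangle_side_nonzero:
  fixes f :: "nat \<Rightarrow> real"
  assumes nonneg: "\<And>k. k \<le> 2 \<Longrightarrow> 0 \<le> f k" and "\<exists>k\<le>2. f k = 0" "\<exists>k\<le>2. 0 < f k"
  shows "(\<Sum>k\<le>2. of_real (f k) * triangle_vertex k) \<noteq> 0"
proof
  assume *: "(\<Sum>k\<le>2. of_real (f k) * triangle_vertex k) = 0"
  have "{..2} = {0, 1, 2::nat}" by auto
  with * have "f 0 = f 1 + f 2" "f 1 = f 2"
    by (auto simp: triangle_vertex_def complex_eq_iff)
  moreover have "f 0 = 0 \<or> f 1 = 0 \<or> f 2 = 0" "0 < f 0 \<or> 0 < f 1 \<or> 0 < f 2"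
    using assms(2,3) by (auto simp: le_Suc_eq numeral_2_eq_2)
  ultimately show False by auto
qed

text \<open>The aim is \<open>a + t * b = (1 - q) * a + q * g\<close>, with \<open>g\<close> nowhere
  zero and a cutoff \<open>q\<close> that is 1 where \<open>cmod a < cmod b\<close> and 0 where
  \<open>b\<close> is too small to divide by. Where \<open>cmod b \<le> cmod a\<close>, the values
  of \<open>a\<close> and \<open>g\<close> lie in a common open half-plane, so their convex
  combinations do not vanish.\<close>

lemma unimodular_pair_unit:
  fixes a b :: "'a \<Rightarrow> complex"
  assumes T: "normal_space T" and dim: "covering_dim_le T 1"
    and a: "continuous_map T euclidean a" and b: "continuous_map T euclidean b"
    and ab: "\<And>x. x \<in> topspace T \<Longrightarrow> a x \<noteq> 0 \<or> b x \<noteq> 0"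
  obtains t where "continuous_map T euclidean t"
    "\<And>x. x \<in> topspace T \<Longrightarrow> a x + t x * b x \<noteq> 0"
proof -
  define h where "h k x = Re (a x * cnj (triangle_vertex k))" for k x
  have h: "continuous_map T euclideanreal (h k)" for k
    unfolding h_def using a by (auto simp: continuous_map_atin intro!: tendsto_intros)
  \<comment> \<open>Where \<open>b\<close> dominates, every index is allowed, as \<open>g\<close>
    will replace \<open>a\<close> there; elsewhere index \<open>k\<close> requires \<open>a\<close>
    to lie in the half-plane of vertex \<open>k\<close>.\<close>
  define W where "W k = {x \<in> topspace T. cmod (a x) < cmod (b x)} \<union> {x \<in> topspace T. 0 < h k x}" for k
  have na: "continuous_map T euclideanreal (\<lambda>x. cmod (a x))"
    and nb: "continuous_map T euclideanreal (\<lambda>x. cmod (b x))"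
    using a b by (auto simp: continuous_map_atin intro!: tendsto_intros)
  have lt: "openin T {x \<in> topspace T. u x < v x}"
    if "continuous_map T euclideanreal u" "continuous_map T euclideanreal v" for u v
  proof -
    have "openin T {x \<in> topspace T. v x - u x \<in> {0<..}}"
      using that by (intro openin_continuous_map_preimage[where Y = euclideanreal] continuous_intros) auto
    then show ?thesis by simp
  qed
  have opW: "openin T (W k)" for k
    unfolding W_def
    by (intro openin_Un lt h na nb) (auto simp: continuous_map_const)
  have covW: "(\<Union>k\<le>Suc 1. W k) = topspace T"
  proof -
    have "\<exists>k\<le>2. x \<in> W k" if x: "x \<in> topspace T" for x
    proof (cases "a x = 0")
      case True
      then show ?thesis using ab[OF x] x by (auto simp: W_def)
    next
      case False
      then show ?thesis using triangle_halfplanes_cover[OF False] x by (auto simp: W_def h_def)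
    qed
    then show ?thesis
      by (auto simp: W_def numeral_2_eq_2)
  qed
  obtain V where V: "\<And>k. k \<le> 2 \<Longrightarrow> openin T (V k)" "\<And>k. k \<le> 2 \<Longrightarrow> V k \<subseteq> W k"
    "(\<Union>k\<le>2. V k) = topspace T" "(\<Inter>k\<le>2. V k) = {}"
    using covering_dim_le_shrink_indexed[OF dim opW covW] by (metis Suc_1)
  have "\<exists>f. (\<forall>i\<in>{..2}. continuous_map T euclideanreal (f i)
              \<and> (\<forall>x\<in>topspace T. 0 \<le> f i x \<and> (x \<notin> V i \<longrightarrow> f i x = 0)))
           \<and> (\<forall>x\<in>topspace T. \<exists>i\<in>{..2}. 0 < f i x)"
    by (rule normal_space_subordinate_functions[OF T]) (use V in auto)
  then obtain f where fc: "\<And>k. k \<le> 2 \<Longrightarrow> continuous_map T euclideanreal (f k)"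
    and f0: "\<And>k x. k \<le> 2 \<Longrightarrow> x \<in> topspace T \<Longrightarrow> 0 \<le> f k x"
    and fV: "\<And>k x. k \<le> 2 \<Longrightarrow> x \<in> topspace T \<Longrightarrow> x \<notin> V k \<Longrightarrow> f k x = 0"
    and fpos: "\<And>x. x \<in> topspace T \<Longrightarrow> \<exists>k\<le>2. 0 < f k x"
    by (auto simp del: atMost_Suc simp: Ball_def) blast
  \<comment> \<open>No point lies in all three \<open>V k\<close>, so on \<open>topspace T\<close>
    the value of \<open>g\<close> is a positive multiple of a boundary point of the
    triangle.\<close>
  define g where "g x = (\<Sum>k\<le>2. of_real (f k x) * triangle_vertex k)" for x
  have g: "continuous_map T euclidean g"
    unfolding g_def using fc
    by (auto simp: continuous_map_atin intro!: tendsto_intros)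
  have g_nz: "g x \<noteq> 0" if x: "x \<in> topspace T" for x
  proof -
    have "\<exists>k\<le>2. x \<notin> V k" using V(4) by auto
    then show ?thesis
      unfolding g_def using x f0 fV fpos by (intro triangle_side_nonzero) blast+
  qed
  have ag: "0 < Re (g x * cnj (a x))" if x: "x \<in> topspace T" and le: "cmod (b x) \<le> cmod (a x)" for x
  proof -
    \<comment> \<open>As \<open>b\<close> does not dominate at \<open>x\<close>, membership in
      \<open>W k\<close> can only come from the half-plane.\<close>
    have pos: "0 < h k x" if "k \<le> 2" "0 < f k x" for k
    proof -
      have "x \<in> W k" using V(2) fV x that by fastforce
      then show ?thesis using le by (auto simp: W_def)
    qed
    have eq: "Re (g x * cnj (a x)) = (\<Sum>k\<le>2. f k x * h k x)"
      by (simp add: g_def h_def sum_distrib_left sum_distrib_right sum.distrib algebra_simps)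
    obtain k where k: "k \<le> 2" "0 < f k x" using fpos x by blast
    have "0 < (\<Sum>k\<le>2. f k x * h k x)"
    proof (rule sum_pos2[where i = k])
      show "0 < f k x * h k x" using pos k by simp
      show "0 \<le> f i x * h i x" if "i \<in> {..2}" for i
        using pos[of i] f0[of i x] that x by (cases "f i x = 0") auto
    qed (use k in auto)
    then show ?thesis using eq by simp
  qed
  define N where "N x = (cmod (a x))\<^sup>2 + (cmod (b x))\<^sup>2" for x
  have N: "0 < N x" if "x \<in> topspace T" for x
    using ab[OF that] by (auto simp: N_def add_pos_nonneg add_nonneg_pos)
  have Nc: "continuous_map T euclideanreal N"
    unfolding N_def using a b by (intro continuous_intros)
  \<comment> \<open>On \<open>topspace T\<close> the quotient is at least 1 where
    \<open>cmod (a x) \<le> cmod (b x)\<close> and at most 0 where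
    \<open>2 * cmod (b x) \<le> cmod (a x)\<close>.\<close>
  define q where "q x = min 1 (max 0 ((4 * (cmod (b x))\<^sup>2 - (cmod (a x))\<^sup>2) / N x))" for x
  have q01: "0 \<le> q x" "q x \<le> 1" for x
    by (auto simp: q_def)
  have qc: "continuous_map T euclideanreal q"
    unfolding q_def using a b Nc less_imp_neq[OF N, THEN not_sym]
    by (auto simp: continuous_map_atin intro!: tendsto_intros)
  \<comment> \<open>\<open>N x / 5\<close> exceeds the square of \<open>cmod (b x)\<close> exactly
    when \<open>2 * cmod (b x) < cmod (a x)\<close>, where \<open>q x = 0\<close>. Elsewhere in
    \<open>topspace T\<close>, \<open>cnj (b x) / M x\<close> is \<open>1 / b x\<close>, while
    \<open>M\<close> stays positive even at the zeros of \<open>b\<close>.\<close>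
  define M where "M x = max ((cmod (b x))\<^sup>2) (N x / 5)" for x
  have Mc: "continuous_map T euclideanreal M"
    unfolding M_def using b Nc
    by (auto simp: continuous_map_atin intro!: tendsto_intros)
  have M: "0 < M x" if "x \<in> topspace T" for x
    using N[OF that] by (auto simp: M_def less_max_iff_disj)
  define t where "t x = of_real (q x) * (g x - a x) * cnj (b x) / of_real (M x)" for x
  show thesis
  proof
    show "continuous_map T euclidean t"
      unfolding t_def using qc g a b Mc less_imp_neq[OF M, THEN not_sym]
      by (auto simp: continuous_map_atin intro!: tendsto_intros)
    fix x assume x: "x \<in> topspace T"
    have tb: "t x * b x = of_real (q x) * (g x - a x)"
    proof (cases "N x / 5 \<le> (cmod (b x))\<^sup>2")
      case True
      then have "M x = (cmod (b x))\<^sup>2" by (simp add: M_def)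
      then have "of_real (M x) = cnj (b x) * b x"
        by (metis complex_norm_square mult.commute of_real_power)
      moreover have "of_real (M x) \<noteq> (0::complex)"
        using M[OF x] by simp
      ultimately show ?thesis
        by (simp add: t_def field_simps)
    next
      case False
      then have "4 * (cmod (b x))\<^sup>2 - (cmod (a x))\<^sup>2 < 0"
        by (simp add: N_def)
      then have "q x = 0"
        using N[OF x] by (simp add: q_def max_def divide_le_0_iff not_le field_simps)
      then show ?thesis
        by (simp add: t_def)
    qed
    show "a x + t x * b x \<noteq> 0"
    proof (cases "cmod (b x) \<le> cmod (a x)")
      case True
      then have "a x \<noteq> 0" using ab[OF x] by auto
      have "Re ((a x + t x * b x) * cnj (a x)) = (1 - q x) * Re (a x * cnj (a x)) + q x * Re (g x * cnj (a x))"
        unfolding tb by (simp add: algebra_simps)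
      moreover have "0 < Re (a x * cnj (a x))"
        using \<open>a x \<noteq> 0\<close> by (simp add: complex_neq_0 flip: power2_eq_square)
      moreover note ag[OF x True]
      moreover have "0 < (1 - q) * u + q * v" if "0 \<le> q" "q \<le> 1" "0 < u" "0 < v" for q u v :: real
        using that by (cases "q = 0") (auto intro!: add_nonneg_pos)
      ultimately have "0 < Re ((a x + t x * b x) * cnj (a x))"
        using q01 by metis
      then show ?thesis by (metis mult_zero_left zero_complex.sel(1) less_irrefl)
    next
      case False
      then have "(cmod (a x))\<^sup>2 \<le> (cmod (b x))\<^sup>2"
        by (simp add: power_mono)
      then have "N x \<le> 4 * (cmod (b x))\<^sup>2 - (cmod (a x))\<^sup>2"
        using zero_le_power2[of "cmod (b x)"] unfolding N_def by linarith
      then have "1 \<le> (4 * (cmod (b x))\<^sup>2 - (cmod (a x))\<^sup>2) / N x"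
        using N[OF x] by simp
      then have "q x = 1" by (simp add: q_def)
      then show ?thesis using tb g_nz[OF x] by simp
    qed
  qed
qed

section \<open>Continuous matrix maps, involutions and 2 by 2 entries\<close>

lemma continuous_map_matrix_mult:
  fixes A B :: "'a \<Rightarrow> complex^'n^'n"
  assumes "continuous_map T euclidean A" "continuous_map T euclidean B"
  shows "continuous_map T euclidean (\<lambda>x. A x ** B x)"
  using assms unfolding continuous_map_atin matrix_matrix_mult_def
  by (auto intro!: tendsto_intros)

lemma continuous_involutionI:
  assumes "continuous_map T euclidean B" "\<And>x. x \<in> topspace T \<Longrightarrow> B x ** B x = mat 1"
  shows "continuous_involution T B"
  using assms
  by (auto simp: continuous_involution_def continuous_map_in_subtopology GL_set_def invertible_def)

lemma continuous_involution_conjugate: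
  fixes B P Q :: "'a \<Rightarrow> complex^'n^'n"
  assumes B: "continuous_map T euclidean B" "\<And>x. x \<in> topspace T \<Longrightarrow> B x ** B x = mat 1"
    and PQ: "continuous_map T euclidean P" "continuous_map T euclidean Q"
      "\<And>x. x \<in> topspace T \<Longrightarrow> Q x ** P x = mat 1" "\<And>x. x \<in> topspace T \<Longrightarrow> P x ** Q x = mat 1"
  shows "continuous_involution T (\<lambda>x. P x ** B x ** Q x)"
proof (rule continuous_involutionI)
  show "continuous_map T euclidean (\<lambda>x. P x ** B x ** Q x)"
    by (intro continuous_map_matrix_mult B PQ)
  fix x assume x: "x \<in> topspace T"
  have "P x ** B x ** Q x ** (P x ** B x ** Q x) = P x ** (B x ** (Q x ** P x) ** B x) ** Q x"
    by (simp only: matrix_mul_assoc)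
  then show "P x ** B x ** Q x ** (P x ** B x ** Q x) = mat 1"
    using B(2)[OF x] PQ(3,4)[OF x] by simp
qed

definition mat2 :: "'a \<Rightarrow> 'a \<Rightarrow> 'a \<Rightarrow> 'a \<Rightarrow> 'a::zero^2^2" where
  "mat2 a b c d = vector [vector [a, b], vector [c, d]]"

lemma mat2_nth [simp]:
  "mat2 a b c d $ 1 $ 1 = a" "mat2 a b c d $ 1 $ 2 = b"
  "mat2 a b c d $ 2 $ 1 = c" "mat2 a b c d $ 2 $ 2 = d"
  by (simp_all add: mat2_def)

lemma matrix_2_eq_iff:
  "(M :: 'a^2^2) = N \<longleftrightarrow>
    M $ 1 $ 1 = N $ 1 $ 1 \<and> M $ 1 $ 2 = N $ 1 $ 2 \<and> M $ 2 $ 1 = N $ 2 $ 1 \<and> M $ 2 $ 2 = N $ 2 $ 2"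
  by (auto simp: vec_eq_iff forall_2)

lemma mat_2_nth:
  "(mat k :: 'a::zero^2^2) $ 1 $ 1 = k" "(mat k :: 'a^2^2) $ 1 $ 2 = 0"
  "(mat k :: 'a^2^2) $ 2 $ 1 = 0" "(mat k :: 'a^2^2) $ 2 $ 2 = k"
  by (simp_all add: mat_def)

lemma matrix_mult_2_nth:
  "((M :: 'a::semiring_1^2^2) ** N) $ i $ j = M $ i $ 1 * N $ 1 $ j + M $ i $ 2 * N $ 2 $ j"
  by (simp add: matrix_matrix_mult_def sum_2)

lemmas matrix_2_simps = matrix_2_eq_iff mat_2_nth matrix_mult_2_nth

lemma continuous_map_mat2:
  fixes a b c d :: "'a \<Rightarrow> complex"
  assumes "continuous_map T euclidean a" "continuous_map T euclidean b"
    "continuous_map T euclidean c" "continuous_map T euclidean d"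
  shows "continuous_map T euclidean (\<lambda>x. mat2 (a x) (b x) (c x) (d x))"
proof -
  \<comment> \<open>The \<open>\<chi>\<close> form makes the entrywise rule
    \<open>tendsto_vec_lambda\<close> applicable.\<close>
  have "mat2 p q r s = (\<chi> i j. if i = 1 then if j = 1 then p else q else if j = 1 then r else s)"
    for p q r s :: complex
    by (simp add: matrix_2_eq_iff)
  moreover have "continuous_map T euclidean
      (\<lambda>x. \<chi> i j. if i = (1::2) then if j = (1::2) then a x else b x else if j = 1 then c x else d x)"
    using assms by (auto simp: continuous_map_atin intro!: tendsto_vec_lambda)
  ultimately show ?thesis
    by simp
qed

lemma continuous_map_matrix_nth:
  fixes A :: "'a \<Rightarrow> complex^'n^'m"
  shows "continuous_map T euclidean A \<Longrightarrow> continuous_map T euclidean (\<lambda>x. A x $ i $ j)"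
  by (auto simp: continuous_map_atin intro!: tendsto_intros)

section \<open>Bounds on the covering dimension, as needed for an interval\<close>

text \<open>With \<open>e\<close> a Lebesgue number of the cover, the open intervals of radius
  \<open>\<delta> = e / 2\<close> about the multiples of \<open>\<delta>\<close> are small enough to
  refine it. A point \<open>x\<close> lies only in those whose index is at distance below 1 from
  \<open>x / \<delta>\<close>, of which there are at most two.\<close>

lemma covering_dim_le_compact_real:
  fixes S :: "real set"
  assumes "compact S"
  shows "covering_dim_le (top_of_set S) 1"
  unfolding covering_dim_le_def
proof (intro allI impI, elim conjE)
  fix \<U> assume op: "\<forall>U\<in>\<U>. openin (top_of_set S) U" and cov: "\<Union>\<U> = topspace (top_of_set S)"
  define \<G> where "\<G> = {G. open G \<and> S \<inter> G \<in> \<U>}"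
  have "S \<subseteq> \<Union>\<G>"
  proof
    fix x assume "x \<in> S"
    then obtain U where U: "U \<in> \<U>" "x \<in> U" using cov by auto
    with op obtain G where "open G" "U = S \<inter> G" by (auto simp: openin_open)
    with U show "x \<in> \<Union>\<G>" by (auto simp: \<G>_def)
  qed
  then obtain e where e: "0 < e" "\<And>x. x \<in> S \<Longrightarrow> \<exists>G\<in>\<G>. ball x e \<subseteq> G"
    by (rule Heine_Borel_lemma[OF assms]) (auto simp: \<G>_def)
  define \<delta> where "\<delta> = e / 2"
  have \<delta>: "0 < \<delta>" using e by (simp add: \<delta>_def)
  define V where "V k = {x \<in> S. \<bar>x - \<delta> * of_int k\<bar> < \<delta>}" for k :: int
  \<comment> \<open>Empty traces are dropped: boundedness of \<open>S\<close> then leaves finitely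
    many indices, and each remaining set has a point \<open>y\<close> whose ball leads to a member
    of \<open>\<U>\<close> containing the set.\<close>
  define \<V> where "\<V> = V ` {k. V k \<noteq> {}}"
  obtain R where R: "\<And>x. x \<in> S \<Longrightarrow> \<bar>x\<bar> \<le> R"
    using compact_imp_bounded[OF assms] by (auto simp: bounded_iff)
  have "{k. V k \<noteq> {}} \<subseteq> {- \<lceil>R / \<delta> + 1\<rceil>..\<lceil>R / \<delta> + 1\<rceil>}"
  proof
    fix k assume "k \<in> {k. V k \<noteq> {}}"
    then obtain x where "x \<in> S" "\<bar>x - \<delta> * of_int k\<bar> < \<delta>" by (auto simp: V_def)
    with R[of x] have "\<bar>\<delta> * of_int k\<bar> \<le> R + \<delta>" by linarith
    then have "\<bar>of_int k\<bar> \<le> R / \<delta> + 1"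
      using \<delta> by (simp add: abs_mult field_simps)
    then show "k \<in> {- \<lceil>R / \<delta> + 1\<rceil>..\<lceil>R / \<delta> + 1\<rceil>}"
      by (auto simp: abs_le_iff) linarith+
  qed
  then have "finite \<V>"
    unfolding \<V>_def using finite_subset by blast
  moreover have "openin (top_of_set S) (V k)" for k
  proof -
    have "V k = S \<inter> {x. \<bar>x - \<delta> * of_int k\<bar> < \<delta>}" by (auto simp: V_def)
    moreover have "open {x. \<bar>x - \<delta> * of_int k\<bar> < \<delta>}"
      by (intro open_Collect_less continuous_intros)
    ultimately show ?thesis by (auto simp: openin_open)
  qed
  moreover have "\<Union>\<V> = S"
  proof -
    have "x \<in> V \<lfloor>x / \<delta>\<rfloor>" if "x \<in> S" for x
    proof -
      define n where "n = \<lfloor>x / \<delta>\<rfloor>"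
      have "of_int n \<le> x / \<delta>" "x / \<delta> < of_int n + 1"
        unfolding n_def by linarith+
      with \<delta> have "\<delta> * of_int n \<le> x" "x < \<delta> * of_int n + \<delta>"
        by (simp_all add: field_simps)
      then show ?thesis using that by (auto simp: V_def simp flip: n_def)
    qed
    moreover have "V k \<subseteq> S" for k by (auto simp: V_def)
    ultimately show ?thesis unfolding \<V>_def by blast
  qed
  moreover have "\<exists>U\<in>\<U>. V k \<subseteq> U" if "V k \<noteq> {}" for k
  proof -
    from that obtain y where y: "y \<in> V k" by blast
    then obtain G where G: "G \<in> \<G>" "ball y e \<subseteq> G" using e(2) by (auto simp: V_def)
    have "e = 2 * \<delta>" by (simp add: \<delta>_def)
    then have "V k \<subseteq> S \<inter> ball y e"
      using y by (auto simp: V_def dist_real_def)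
    then show ?thesis using G unfolding \<G>_def by blast
  qed
  moreover have "card {W \<in> \<V>. x \<in> W} \<le> 1 + 1" for x
  proof -
    have "{W \<in> \<V>. x \<in> W} \<subseteq> {V \<lfloor>x / \<delta>\<rfloor>, V (\<lfloor>x / \<delta>\<rfloor> + 1)}"
    proof
      fix W assume "W \<in> {W \<in> \<V>. x \<in> W}"
      then obtain k where k: "W = V k" "x \<in> V k" by (auto simp: \<V>_def)
      then have "\<delta> * of_int k - \<delta> < x" "x < \<delta> * of_int k + \<delta>" by (auto simp: V_def)
      with \<delta> have "of_int k - 1 < x / \<delta>" "x / \<delta> < of_int k + 1"
        by (simp_all add: field_simps)
      then have "k = \<lfloor>x / \<delta>\<rfloor> \<or> k = \<lfloor>x / \<delta>\<rfloor> + 1" by linarith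
      then show "W \<in> {V \<lfloor>x / \<delta>\<rfloor>, V (\<lfloor>x / \<delta>\<rfloor> + 1)}" using k by auto
    qed
    then have "card {W \<in> \<V>. x \<in> W} \<le> card {V \<lfloor>x / \<delta>\<rfloor>, V (\<lfloor>x / \<delta>\<rfloor> + 1)}"
      by (intro card_mono) auto
    also have "\<dots> \<le> 1 + 1"
      by (simp add: card_insert_if)
    finally show ?thesis .
  qed
  ultimately show "\<exists>\<V>. finite \<V> \<and> (\<forall>V\<in>\<V>. openin (top_of_set S) V) \<and> \<Union>\<V> = topspace (top_of_set S)
             \<and> (\<forall>V\<in>\<V>. \<exists>U\<in>\<U>. V \<subseteq> U)
             \<and> (\<forall>x\<in>topspace (top_of_set S). card {V\<in>\<V>. x \<in> V} \<le> 1 + 1)"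
    by (intro exI[of _ \<V>]) (auto simp: \<V>_def)
qed

text \<open>Refine the cover by the complements of \<open>x\<close> and \<open>y\<close>. Order at
  most 1 makes the members pairwise disjoint, hence clopen. By connectedness the member containing
  \<open>x\<close> is the whole space, yet it must miss \<open>x\<close> or
  \<open>y\<close>.\<close>

lemma connected_not_covering_dim_le_0:
  assumes T: "connected_space T" "t1_space T" and xy: "x \<in> topspace T" "y \<in> topspace T" "x \<noteq> y"
  shows "\<not> covering_dim_le T 0"
proof
  assume "covering_dim_le T 0"
  moreover have "finite {topspace T - {x}, topspace T - {y}}
      \<and> (\<forall>U\<in>{topspace T - {x}, topspace T - {y}}. openin T U)
      \<and> \<Union>{topspace T - {x}, topspace T - {y}} = topspace T"
    using T xy by (auto simp: t1_space_closedin_singleton)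
  ultimately obtain \<V> where \<V>: "finite \<V>" "\<And>V. V \<in> \<V> \<Longrightarrow> openin T V" "\<Union>\<V> = topspace T"
      "\<And>V. V \<in> \<V> \<Longrightarrow> \<exists>U\<in>{topspace T - {x}, topspace T - {y}}. V \<subseteq> U"
      "\<And>z. z \<in> topspace T \<Longrightarrow> card {V\<in>\<V>. z \<in> V} \<le> 0 + 1"
    unfolding covering_dim_le_def by (smt (verit, best))
  obtain V where V: "V \<in> \<V>" "x \<in> V" using \<V>(3) xy by blast
  have disj: "W = V" if "W \<in> \<V>" "z \<in> W" "z \<in> V" for W z
  proof -
    have "z \<in> topspace T" using that \<V>(3) by blast
    then have "card {V\<in>\<V>. z \<in> V} \<le> Suc 0" using \<V>(5) by simp
    then show ?thesis
      using card_le_Suc0_iff_eq[of "{V\<in>\<V>. z \<in> V}"] \<V>(1) that V(1) by auto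
  qed
  have eq: "topspace T - V = \<Union>(\<V> - {V})"
    using \<V>(3) V(1) disj by blast
  have "openin T (topspace T - V)"
    unfolding eq using \<V>(2) by (intro openin_Union) auto
  then have "closedin T V"
    using V(1) \<V>(3) by (auto simp: closedin_def)
  moreover have "openin T V" using V \<V> by blast
  ultimately have "V = topspace T"
    using T(1) V(2) by (auto simp: connected_space_clopen_in)
  then show False using \<V>(4)[OF V(1)] V(2) xy by auto
qed

section \<open>Involutions of size 2\<close>

text \<open>The off-diagonal entries of \<open>B ** B\<close> are \<open>b * (a + d)\<close> and
  \<open>c * (a + d)\<close>. A nonzero trace thus makes \<open>B\<close> diagonal with entries
  \<open>1\<close> or \<open>-1\<close>, which must agree; for trace zero,
  \<open>a * a + b * c = 1\<close> is \<open>- det B\<close>.\<close>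

lemma involution_2_cases:
  fixes B :: "complex^2^2"
  assumes "B ** B = mat 1"
  obtains "B = mat 1" | "B = mat (-1)" | "trace B = 0" "det B = -1"
proof -
  define a b c d where "a = B $ 1 $ 1" "b = B $ 1 $ 2" "c = B $ 2 $ 1" "d = B $ 2 $ 2"
  have eqs: "a * a + b * c = 1" "a * b + b * d = 0" "c * a + d * c = 0" "c * b + d * d = 1"
    using assms by (auto simp: matrix_2_simps a_b_c_d_def)
  show thesis
  proof (cases "a + d = 0")
    case True
    then have "d = -a" by algebra
    with eqs(1) have "a * d - b * c = -1" by algebra
    then show ?thesis
      using True that(3) by (auto simp: trace_def sum_2 det_2 a_b_c_d_def)
  next
    case False
    have "b * (a + d) = 0" "c * (a + d) = 0" using eqs by algebra+
    with False have "b = 0" "c = 0" by auto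
    with eqs have "a * a = 1" "d * d = 1" by auto
    then have "a = 1 \<or> a = -1" "d = 1 \<or> d = -1"
      by (simp_all add: square_eq_1_iff)
    then have "a = 1 \<and> d = 1 \<or> a = -1 \<and> d = -1"
      using False by auto
    with \<open>b = 0\<close> \<open>c = 0\<close> show ?thesis
      using that(1,2) by (auto simp: matrix_2_simps a_b_c_d_def)
  qed
qed

text \<open>The trace is continuous with values among 2, -2 and 0, so it is constant on a connected
  set and selects the same case at every point.\<close>

lemma continuous_involution_connected_cases:
  fixes B :: "real \<Rightarrow> complex^2^2"
  assumes B: "continuous_involution (top_of_set S) B" and S: "connected S"
  obtains s where "s * s = 1" "\<And>x. x \<in> S \<Longrightarrow> B x = mat s"
  | "\<And>x. x \<in> S \<Longrightarrow> trace (B x) = 0" "\<And>x. x \<in> S \<Longrightarrow> det (B x) = -1"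
proof -
  have inv: "B x ** B x = mat 1" if "x \<in> S" for x
    using B that by (simp add: continuous_involution_def)
  have tr: "trace (mat k :: complex^2^2) = 2 * k" for k
    by (simp add: trace_def sum_2 mat_2_nth)
  have cases: "B x = mat 1 \<and> trace (B x) = 2 \<or> B x = mat (-1) \<and> trace (B x) = -2
      \<or> trace (B x) = 0 \<and> det (B x) = -1" if "x \<in> S" for x
    by (rule involution_2_cases[OF inv[OF that]]) (simp_all add: tr)
  have "continuous_on S B"
    using B by (auto simp: continuous_involution_def continuous_map_in_subtopology)
  then have "continuous_on S (\<lambda>x. trace (B x))"
    unfolding trace_def by (intro continuous_intros)
  moreover have "finite ((\<lambda>x. trace (B x)) ` S)"
    by (rule finite_subset[of _ "{2, -2, 0}"]) (use cases in auto)
  ultimately have "(\<lambda>x. trace (B x)) constant_on S"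
    by (rule continuous_finite_range_constant[OF S])
  then obtain k where k: "\<And>x. x \<in> S \<Longrightarrow> trace (B x) = k"
    by (auto simp: constant_on_def)
  \<comment> \<open>For empty \<open>S\<close> the constant \<open>k\<close> is arbitrary, so the
    last case is not stated as \<open>k = 0\<close>.\<close>
  consider "k = 2" | "k = -2" | "k \<noteq> 2" "k \<noteq> -2" by blast
  then show thesis
  proof cases
    case 1
    then have "B x = mat 1" if "x \<in> S" for x
      using cases[OF that] k[OF that] by auto
    then show ?thesis using that(1)[of 1] by simp
  next
    case 2
    then have "B x = mat (-1)" if "x \<in> S" for x
      using cases[OF that] k[OF that] by auto
    then show ?thesis using that(1)[of "-1"] by simp
  next
    case 3
    then have "trace (B x) = 0 \<and> det (B x) = -1" if "x \<in> S" for x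
      using cases[OF that] k[OF that] by auto
    then show ?thesis using that(2) by blast
  qed
qed

section \<open>Four involutions suffice\<close>

lemma product_of_four_involutions:
  fixes A :: "'a \<Rightarrow> complex^2^2"
  assumes T: "normal_space T" "covering_dim_le T 1" and A: "SL_cont T A"
  shows "product_of_involutions T 4 A"
proof -
  have Ac: "continuous_map T euclidean A" and det: "\<And>x. x \<in> topspace T \<Longrightarrow> det (A x) = 1"
    using A by (auto simp: SL_cont_def SL_set_def continuous_map_in_subtopology)
  define a b c d where abcd: "a x = A x $ 1 $ 1" "b x = A x $ 1 $ 2" "c x = A x $ 2 $ 1" "d x = A x $ 2 $ 2" for x
  have cont: "continuous_map T euclidean a" "continuous_map T euclidean b"
    "continuous_map T euclidean c" "continuous_map T euclidean d"
    unfolding abcd by (intro continuous_map_matrix_nth Ac)+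
  have adbc: "a x * d x - b x * c x = 1" if "x \<in> topspace T" for x
    using det[OF that] by (simp add: det_2 abcd)
  obtain t where t: "continuous_map T euclidean t"
    and nz: "\<And>x. x \<in> topspace T \<Longrightarrow> a x + t x * b x \<noteq> 0"
  proof (rule unimodular_pair_unit[OF T cont(1,2)])
    show "a x \<noteq> 0 \<or> b x \<noteq> 0" if "x \<in> topspace T" for x
      using adbc[OF that] by auto
  qed (blast intro: that)
  \<comment> \<open>With \<open>P\<close> as below, \<open>u\<close> and \<open>e\<close> form the
    first column of \<open>A ** P\<close>.\<close>
  define u e where ue: "u x = a x + t x * b x" "e x = c x + t x * d x" for x
  have u: "u x \<noteq> 0" if "x \<in> topspace T" for x
    using nz[OF that] by (simp add: ue)
  have uc: "continuous_map T euclidean u" and ec: "continuous_map T euclidean e"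
    unfolding ue using cont t by (auto simp: continuous_map_atin intro!: tendsto_intros)
  define P Q where PQ: "P x = mat2 1 0 (t x) 1" "Q x = mat2 1 0 (- t x) 1" for x
  have PQc: "continuous_map T euclidean P" "continuous_map T euclidean Q"
    unfolding PQ using t
    by (intro continuous_map_mat2; auto simp: continuous_map_atin intro!: tendsto_intros)+
  have QP: "Q x ** P x = mat 1" and PQ1: "P x ** Q x = mat 1" for x
    by (auto simp: PQ matrix_2_simps)
  \<comment> \<open>For the factorization \<open>L ** diag(u, 1/u) ** U\<close> of
    \<open>Q ** A ** P\<close>, \<open>X\<close> is \<open>L ** \<sigma>\<close>, \<open>Y\<close>
    is \<open>\<sigma> ** U\<close>, and \<open>D ** E\<close> is
    \<open>diag(u, 1/u)\<close>.\<close>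
  define X where "X x = mat2 1 0 (e x / u x - t x) (-1)" for x
  define D where "D x = mat2 0 (u x) (1 / u x) 0" for x
  define E where "E x = mat2 0 1 1 (0::complex)" for x :: 'a
  define Y where "Y x = mat2 1 (b x / u x) 0 (-1)" for x
  have "continuous_map T euclidean X" "continuous_map T euclidean D"
    "continuous_map T euclidean E" "continuous_map T euclidean Y"
    unfolding X_def D_def E_def Y_def using cont t uc ec u
    by (intro continuous_map_mat2; auto simp: continuous_map_atin intro!: tendsto_intros)+
  moreover have "X x ** X x = mat 1" "E x ** E x = mat 1" "Y x ** Y x = mat 1" for x
    by (simp_all add: X_def E_def Y_def matrix_2_simps)
  moreover have "D x ** D x = mat 1" if "x \<in> topspace T" for x
    using u[OF that] by (simp add: D_def matrix_2_simps)
  ultimately have inv: "continuous_involution T (\<lambda>x. P x ** B x ** Q x)" if "B \<in> {X, D, E, Y}" for B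
    using that by (intro continuous_involution_conjugate PQc QP PQ1) auto
  have "A x = P x ** X x ** Q x ** (P x ** D x ** Q x ** (P x ** E x ** Q x ** (P x ** Y x ** Q x)))"
    if x: "x \<in> topspace T" for x
  proof -
    have "P x ** X x ** Q x ** (P x ** D x ** Q x ** (P x ** E x ** Q x ** (P x ** Y x ** Q x)))
        = P x ** X x ** (Q x ** P x) ** D x ** (Q x ** P x) ** E x ** (Q x ** P x) ** Y x ** Q x"
      by (simp only: matrix_mul_assoc)
    also have "\<dots> = P x ** (X x ** (D x ** (E x ** Y x))) ** Q x"
      by (simp add: QP matrix_mul_assoc)
    \<comment> \<open>The right-hand side is \<open>Q x ** A x ** P x\<close>; the lower right
      entries agree because \<open>det (A x ** P x) = 1\<close>.\<close>
    also have "X x ** (D x ** (E x ** Y x)) = mat2 (u x) (b x) (e x - t x * u x) (d x - t x * b x)"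
    proof -
      have "d x * u x = e x * b x + 1"
        using adbc[OF x] unfolding ue by algebra
      then show ?thesis
        using u[OF x] by (simp add: X_def D_def E_def Y_def matrix_2_simps field_simps)
    qed
    also have "P x ** \<dots> ** Q x = A x"
      by (simp add: PQ matrix_2_simps ue abcd[symmetric] algebra_simps)
    finally show ?thesis by simp
  qed
  then show ?thesis
    unfolding product_of_involutions_def
    by (intro exI[of _ "map (\<lambda>B x. P x ** B x ** Q x) [X, D, E, Y]"]) (auto intro!: inv)
qed

section \<open>Three involutions do not suffice\<close>

text \<open>\<open>mat 1\<close> is itself an involution, so a shorter product can be padded. Hence
  excluding three factors excludes every smaller number.\<close>

lemma product_of_involutions_mono:
  fixes A :: "'a \<Rightarrow> complex^'n^'n"
  assumes "product_of_involutions T m A" "m \<le> n"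
  shows "product_of_involutions T n A"
proof -
  obtain Bs where Bs: "length Bs = m" "\<forall>B\<in>set Bs. continuous_involution T B"
    "\<forall>x\<in>topspace T. A x = foldr (\<lambda>B M. B x ** M) Bs (mat 1)"
    using assms(1) by (auto simp: product_of_involutions_def)
  have "continuous_involution T (\<lambda>x. mat 1)"
    by (intro continuous_involutionI) auto
  moreover have "foldr (\<lambda>B M. B x ** M) (replicate k (\<lambda>x. mat 1)) (mat 1 :: complex^'n^'n) = mat 1"
    for k and x :: 'a
    by (induction k) auto
  ultimately show ?thesis
    unfolding product_of_involutions_def using Bs assms(2)
    by (intro exI[of _ "Bs @ replicate (n - m) (\<lambda>x. mat 1)"]) auto
qed

text \<open>Two of the three involutions have determinant \<open>-1\<close> and the third is \<open>\<plusminus>1\<close>.\<close>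

lemma product_of_three_involutions_trace:
  fixes A :: "real \<Rightarrow> complex^2^2"
  assumes A: "product_of_involutions (top_of_set S) 3 A" and S: "connected S"
    and det: "\<And>x. x \<in> S \<Longrightarrow> det (A x) = 1" and z: "z \<in> S" "A z $ 1 $ 2 \<noteq> 0"
  obtains B where "continuous_involution (top_of_set S) B"
    "\<And>x. x \<in> S \<Longrightarrow> trace (B x) = 0" "\<And>x. x \<in> S \<Longrightarrow> trace (B x ** A x) = 0"
proof -
  obtain Bs where Bs: "length Bs = 3" "\<forall>B\<in>set Bs. continuous_involution (top_of_set S) B"
    "\<forall>x\<in>topspace (top_of_set S). A x = foldr (\<lambda>B M. B x ** M) Bs (mat 1)"
    using A by (auto simp: product_of_involutions_def)
  then obtain F G H where "Bs = [F, G, H]"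
    by (auto simp: numeral_3_eq_3 length_Suc_conv)
  with Bs have inv: "continuous_involution (top_of_set S) F" "continuous_involution (top_of_set S) G"
      "continuous_involution (top_of_set S) H"
    and eq: "\<And>x. x \<in> S \<Longrightarrow> A x = F x ** (G x ** H x)"
    by auto
  have sq: "F x ** F x = mat 1" "G x ** G x = mat 1" "H x ** H x = mat 1" if "x \<in> S" for x
    using inv that by (auto simp: continuous_involution_def)
  have det3: "det (F x) * (det (G x) * det (H x)) = 1" if "x \<in> S" for x
    using det[OF that] eq[OF that] by (simp add: det_mul)
  have det_s: "det (mat s :: complex^2^2) = s * s" for s
    by (simp add: det_2 mat_2_nth)
  have tr_s: "trace (mat s ** M) = s * trace M" for s and M :: "complex^2^2"
    by (simp add: trace_def sum_2 matrix_mult_2_nth mat_2_nth algebra_simps)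
  have comm: "mat s ** M = M ** mat s" for s and M :: "complex^2^2"
    by (simp add: matrix_2_simps mult.commute)
  let ?tf = "\<lambda>B. (\<forall>x\<in>S. trace (B x) = 0) \<and> (\<forall>x\<in>S. det (B x) = (-1::complex))"
  let ?sc = "\<lambda>B s. s * s = (1::complex) \<and> (\<forall>x\<in>S. (B x :: complex^2^2) = mat s)"
  have F: "(\<exists>s. ?sc F s) \<or> ?tf F"
    by (rule continuous_involution_connected_cases[OF inv(1) S]) blast+
  have G: "(\<exists>s. ?sc G s) \<or> ?tf G"
    by (rule continuous_involution_connected_cases[OF inv(2) S]) blast+
  have H: "(\<exists>s. ?sc H s) \<or> ?tf H"
    by (rule continuous_involution_connected_cases[OF inv(3) S]) blast+
  have dz: "det (F z) * (det (G z) * det (H z)) = 1" by (rule det3[OF z(1)])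
  \<comment> \<open>Three scalar factors would make \<open>A z\<close> scalar, against its
    off-diagonal entry. As \<open>det (A z) = 1\<close>, the number of factors of determinant
    \<open>-1\<close> is even, and so it is two.\<close>
  have not_scalar: "\<not> (F z = mat r \<and> G z = mat s \<and> H z = mat t)" for r s t
    using z eq[OF z(1)] by (auto simp: matrix_mult_2_nth mat_2_nth)
  consider s where "?sc F s" "?tf G" "?tf H" | s where "?tf F" "?sc G s" "?tf H"
    | s where "?tf F" "?tf G" "?sc H s"
  proof -
    have "det (F z) = 1 \<or> ?tf F" "det (G z) = 1 \<or> ?tf G" "det (H z) = 1 \<or> ?tf H"
      using F G H det_s z(1) by auto
    then show ?thesis
      using that F G H not_scalar dz z(1)
      by (smt (verit) mult_cancel_left1 mult_minus1 neg_equal_0_iff_equal one_neq_neg_one minus_minus)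
  qed
  then show thesis
  proof cases
    case 1
    \<comment> \<open>The scalar \<open>s\<close> commutes past \<open>G\<close>, whose square
      cancels, leaving \<open>s\<close> times the traceless \<open>H\<close>. In the other two cases
      \<open>F\<close> cancels in the same way.\<close>
    have "trace (G x ** A x) = 0" if "x \<in> S" for x
    proof -
      have "G x ** A x = mat s ** (G x ** G x ** H x)"
        using eq[OF that] 1 that by (simp add: matrix_2_simps algebra_simps)
      then show ?thesis using sq tr_s 1 that by simp
    qed
    then show ?thesis using that[of G] inv 1 by blast
  next
    case 2
    have "trace (F x ** A x) = 0" if "x \<in> S" for x
    proof -
      have "F x ** A x = F x ** F x ** (mat s ** H x)"
        using eq 2 that by (simp add: matrix_mul_assoc)
      then show ?thesis using sq tr_s 2 that by simp
    qed
    then show ?thesis using that[of F] inv 2 by blast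
  next
    case 3
    have "trace (F x ** A x) = 0" if "x \<in> S" for x
    proof -
      have "F x ** A x = F x ** F x ** (mat s ** G x)"
        using eq 3 that by (simp add: comm matrix_mul_assoc)
      then show ?thesis using sq tr_s 3 that by simp
    qed
    then show ?thesis using that[of F] inv 3 by blast
  qed
qed

text \<open>Using \<open>max\<close> and \<open>min\<close>, one continuous formula joins the upper
  unitriangular matrices for \<open>x \<le> 0\<close> to the diagonal ones for
  \<open>x \<ge> 0\<close>.\<close>

definition bent_path :: "real \<Rightarrow> complex^2^2" where
  "bent_path x = mat2 (exp (of_real (max 0 x))) (of_real (min 0 x)) 0 (exp (of_real (- max 0 x)))"

lemma continuous_on_bent_path: "continuous_on S bent_path"
proof -
  have "continuous_map (top_of_set S) euclidean bent_path"
    unfolding bent_path_def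
    by (intro continuous_map_mat2) (auto intro!: continuous_intros)
  then show ?thesis by simp
qed

lemma det_bent_path: "det (bent_path x) = 1"
  by (simp add: bent_path_def det_2 flip: exp_add)

text \<open>A traceless \<open>B\<close> with \<open>trace (B ** bent_path) = 0\<close> has lower left entry \<open>0\<close> to the left
  of \<open>0\<close> and diagonal \<open>0\<close> to the right of it, so it is nilpotent at \<open>0\<close>.\<close>

lemma bent_path_not_product_of_three_involutions:
  "\<not> product_of_involutions (top_of_set {-1..1}) 3 bent_path"
proof
  assume "product_of_involutions (top_of_set {-1..1}) 3 bent_path"
  then obtain B where B: "continuous_involution (top_of_set {-1..1}) B"
    and tr: "\<And>x. x \<in> {-1..1} \<Longrightarrow> trace (B x) = 0"
    and trA: "\<And>x. x \<in> {-1..1} \<Longrightarrow> trace (B x ** bent_path x) = 0"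
  proof (rule product_of_three_involutions_trace[where z = "-1"])
    show "bent_path (-1) $ 1 $ 2 \<noteq> 0" by (simp add: bent_path_def)
  qed (auto simp: det_bent_path)
  have Bc: "continuous_on {-1..1} B"
    using B by (auto simp: continuous_involution_def continuous_map_in_subtopology)
  \<comment> \<open>An entry that vanishes on one side of 0 vanishes at 0 by continuity; this brings
    the conditions from both sides together.\<close>
  have zero: "B 0 $ i $ j = 0"
    if "0 \<in> closure S" "closure S \<subseteq> {-1..1}" "\<And>x. x \<in> S \<Longrightarrow> B x $ i $ j = 0" for S i j
  proof (rule continuous_constant_on_closure[OF _ that(3,1)])
    show "continuous_on (closure S) (\<lambda>x. B x $ i $ j)"
      by (intro continuous_intros continuous_on_subset[OF Bc that(2)])
  qed
  \<comment> \<open>Here \<open>trace (B x ** bent_path x)\<close> is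
    \<open>trace (B x) + x * B x $ 2 $ 1\<close>.\<close>
  have "B x $ 2 $ 1 = 0" if "x \<in> {-1<..<0}" for x
    using that tr[of x] trA[of x]
    by (simp add: trace_def sum_2 matrix_mult_2_nth bent_path_def add_eq_0_iff)
  then have c: "B 0 $ 2 $ 1 = 0"
    by (rule zero[of "{-1<..<0}", rotated 2]) auto
  have "B x $ 1 $ 1 = 0" if x: "x \<in> {0<..<1}" for x
  proof -
    have "B x $ 2 $ 2 = - B x $ 1 $ 1"
      using x tr[of x] by (simp add: trace_def sum_2 add_eq_0_iff)
    then have "B x $ 1 $ 1 * (exp (of_real x) - exp (- of_real x)) = 0"
      using x trA[of x] by (simp add: trace_def sum_2 matrix_mult_2_nth bent_path_def algebra_simps)
    moreover have "exp (of_real x) \<noteq> (exp (- of_real x) :: complex)"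
      using x by (simp flip: of_real_minus of_real_exp add: exp_of_real)
    ultimately show ?thesis by simp
  qed
  then have a: "B 0 $ 1 $ 1 = 0"
    by (rule zero[of "{0<..<1}", rotated 2]) auto
  have "B 0 ** B 0 = mat 1"
    using B by (simp add: continuous_involution_def)
  \<comment> \<open>The upper left entry of \<open>B 0 ** B 0\<close> is 0, since each of its two
    products has a vanishing factor.\<close>
  with a c show False
    by (simp add: matrix_2_simps)
qed

section \<open>The exact value 4, with the interval from -1 to 1 as witness for the lower
  bound\<close>

theorem proposition3p8:
  shows "involutions_suffice TYPE('a) TYPE(2) 1 4
       \<and> (\<forall>m. involutions_suffice TYPE(real) TYPE(2) 1 m \<longrightarrow> 4 \<le> m)"
proof (intro conjI allI impI)
  show "involutions_suffice TYPE('a) TYPE(2) 1 4"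
    unfolding involutions_suffice_def has_covering_dim_def
    by (blast intro: product_of_four_involutions)
  fix m assume m: "involutions_suffice TYPE(real) TYPE(2) 1 m"
  let ?T = "top_of_set {-1..1::real}"
  have "normal_space ?T"
    by (intro metrizable_imp_normal_space metrizable_space_subtopology metrizable_space_euclidean)
  moreover have "has_covering_dim ?T 1"
  proof -
    have "\<not> covering_dim_le ?T 0"
      by (rule connected_not_covering_dim_le_0[of _ 0 1])
        (auto simp flip: connectedin_topspace intro!: Hausdorff_imp_t1_space Hausdorff_space_subtopology)
    then show ?thesis
      using covering_dim_le_compact_real[of "{-1..1}"] by (simp add: has_covering_dim_def)
  qed
  moreover have cont: "continuous_map ?T (top_of_set SL_set) bent_path"
    using continuous_on_bent_path by (auto simp: continuous_map_in_subtopology SL_set_def det_bent_path)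
  then have "SL_cont ?T bent_path"
    by (simp add: SL_cont_def)
  moreover have "null_homotopic_SL ?T bent_path"
  proof -
    have "contractible {-1..1::real}"
      by (simp add: convex_imp_contractible)
    then obtain C where C: "homotopic_with (\<lambda>_. True) ?T (top_of_set SL_set) bent_path (\<lambda>_. C)"
      using nullhomotopic_from_contractible_space[OF cont] by auto
    \<comment> \<open>Contractibility of the interval yields some constant \<open>C\<close>; that it
      has determinant 1 is read off from the constant map at the point 0.\<close>
    then have "continuous_map ?T (top_of_set SL_set) (\<lambda>_. C)"
      using homotopic_with_imp_continuous_maps by blast
    from continuous_map_funspace[OF this] have "(\<lambda>_. C) \<in> {-1..1::real} \<rightarrow> SL_set"
      by simp
    then have "C \<in> SL_set"
      by (rule Pi_mem[of _ _ _ 0]) simp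
    with C show ?thesis by (auto simp: null_homotopic_SL_def)
  qed
  ultimately have "product_of_involutions ?T m bent_path"
    using m unfolding involutions_suffice_def by blast
  then have "\<not> m \<le> 3"
    using product_of_involutions_mono bent_path_not_product_of_three_involutions by blast
  then show "4 \<le> m"
    by simp
qed

end
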